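(* Let $K,L\in\mathcal{K}^n$, let $\phi_1,\phi_2\in\Phi$, and let $i$ be an integer with $0\le i<n$. Then $$\frac{(\phi_1)'_r(1)}{n-i}\cdot\frac{d}{d\varepsilon}\bigg|_{\varepsilon=0^+}A_i(K+_\phi\varepsilon\cdot L)=\frac1n\int_{S^{n-1}}\phi_2\left(\frac{b(L,u)}{b(K,u)}\right) b(K,u)^{n-i}\,dS(u).$$
   Context: $\mathcal{K}^n$ is the class of convex bodies (compact convex sets with nonempty interior) in $\mathbb{R}^n$ containing the origin in their interiors. The support function is $h(K,x)=\max\{x\cdot y:y\in K\}$, and the half width of $K$ in direction $u\in S^{n-1}$ is $b(K,u)=\frac12(h(K,u)+h(K,-u))$. $dS$ is the surface area measure on the unit sphere $S^{n-1}$. For an integer $0\le i<n$ the width integral is $A_i(K)=\frac1n\int_{S^{n-1}}b(K,u)^{n-i}\,dS(u)$. $\Phi$ is the set of convex, strictly decreasing functions $\phi$ on $[0,\infty)$, with values in $(0,\infty)$ on $(0,\infty)$, such that $\phi(0)=\infty$, $\phi(1)=1$ and $\phi(\infty)=0$ (the values at $0$ and $\infty$ are understood as limits). $(\phi_1)'_r$ denotes the right derivative. For $K,L\in\mathcal{K}^n$, $\phi_1,\phi_2\in\Phi$ and $\varepsilon\ge0$, the Orlicz width linear combination $K+_\phi\varepsilon\cdot L$ is defined through its half width function: for every $u\in S^{n-1}$, $b(K+_\phi\varepsilon\cdot L,u)$ is the positive number satisfying $$\phi_1\left(\frac{b(K,u)}{b(K+_\phi\varepsilon\cdot L,u)}\right)+\varepsilon\,\phi_2\left(\frac{b(L,u)}{b(K+_\phi\varepsilon\cdot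 L,u)}\right)=1.$$ The quantity $A_i(K+_\phi\varepsilon\cdot L)$ is $\frac1n\int_{S^{n-1}}b(K+_\phi\varepsilon\cdot L,u)^{n-i}\,dS(u)$. The derivative at $\varepsilon=0^+$ is the one-sided derivative $\lim_{\varepsilon\to0^+}\frac{A_i(K+_\phi\varepsilon\cdot L)-A_i(K)}{\varepsilon}$. *)

theory Defs
  imports "HOL-Analysis.Analysis"
begin

definition convex_bodies :: "(real ^ 'n) set set" where
  "convex_bodies = {K. compact K \<and> convex K \<and> 0 \<in> interior K}"

definition support_fun :: "(real ^ 'n) set \<Rightarrow> real ^ 'n \<Rightarrow> real" where
  "support_fun K x = (SUP y\<in>K. x \<bullet> y)"

definition half_width :: "(real ^ 'n) set \<Rightarrow> real ^ 'n \<Rightarrow> real" where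
  "half_width K u = (support_fun K u + support_fun K (- u)) / 2"

text \<open>Surface area measure on the unit sphere, as in polar coordinates: the measure of a
  Borel set \<open>A\<close> is \<open>n\<close> times the Lebesgue measure of the cone \<open>{t *\<^sub>R u | t u. 0 < t < 1 \<and> u \<in> A}\<close>
  (see \<open>emeasure_sphere_measure\<close>). Here \<open>sgn x = x /\<^sub>R norm x\<close> is the radial projection.\<close>

definition sphere_measure :: "(real ^ 'n) measure" where
  "sphere_measure = scale_measure (of_nat CARD('n))
     (distr (restrict_space lborel (ball 0 1 - {0})) (restrict_space borel (sphere 0 1)) sgn)"

lemma space_sphere_measure [simp]: "space sphere_measure = sphere 0 1"
  by (simp add: sphere_measure_def space_scale_measure space_restrict_space)

lemma sets_sphere_measure: "sets sphere_measure = sets (restrict_space borel (sphere 0 1))"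
  by (simp add: sphere_measure_def)

lemma sgn_measurable_sphere:
  "sgn \<in> measurable (restrict_space lborel (ball 0 1 - {0})) (restrict_space borel (sphere (0 :: real ^ 'n) 1))"
proof (rule measurable_restrict_space2)
  show "sgn \<in> space (restrict_space lborel (ball 0 1 - {0})) \<rightarrow> sphere (0 :: real ^ 'n) 1"
    by (auto simp: space_restrict_space norm_sgn)
  have "(sgn :: real ^ 'n \<Rightarrow> _) = (\<lambda>x. x /\<^sub>R norm x)"
    by (simp add: fun_eq_iff sgn_div_norm)
  then have "(sgn :: real ^ 'n \<Rightarrow> _) \<in> borel_measurable borel" by simp
  then show "sgn \<in> borel_measurable (restrict_space lborel (ball (0 :: real ^ 'n) 1 - {0}))"
    by (intro measurable_restrict_space1) simp
qed

lemma emeasure_sphere_measure: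
  fixes A :: "(real ^ 'n) set"
  assumes "A \<in> sets borel" "A \<subseteq> sphere 0 1"
  shows "emeasure sphere_measure A =
    of_nat CARD('n) * emeasure lborel {t *\<^sub>R u | t u. 0 < t \<and> t < 1 \<and> u \<in> A}"
proof -
  let ?B = "ball (0 :: real ^ 'n) 1 - {0}"
  have A: "A \<in> sets (restrict_space borel (sphere 0 1))"
    using assms by (simp add: sets_restrict_space_iff)
  have cone: "sgn -` A \<inter> ?B = {t *\<^sub>R u | t u. 0 < t \<and> t < 1 \<and> u \<in> A}"
  proof (intro equalityI subsetI)
    fix x assume x: "x \<in> sgn -` A \<inter> ?B"
    then have "x = norm x *\<^sub>R sgn x" "0 < norm x" "norm x < 1" "sgn x \<in> A"
      by (auto simp: sgn_div_norm)
    then show "x \<in> {t *\<^sub>R u | t u. 0 < t \<and> t < 1 \<and> u \<in> A}" by blast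
  next
    fix x assume "x \<in> {t *\<^sub>R u | t u. 0 < t \<and> t < 1 \<and> u \<in> A}"
    then obtain t u where "x = t *\<^sub>R u" "0 < t" "t < 1" "u \<in> A" by blast
    moreover from this have "norm u = 1" using assms(2) by auto
    ultimately show "x \<in> sgn -` A \<inter> ?B" by (auto simp: sgn_div_norm)
  qed
  have "emeasure (distr (restrict_space lborel ?B) (restrict_space borel (sphere 0 1)) sgn) A =
      emeasure lborel {t *\<^sub>R u | t u. 0 < t \<and> t < 1 \<and> u \<in> A}"
    by (subst emeasure_distr[OF sgn_measurable_sphere A])
       (simp add: space_restrict_space emeasure_restrict_space flip: cone)
  then show ?thesis
    by (simp add: sphere_measure_def)
qed

text \<open>The width integral as a functional of the half width function, because the Orlicz width
  linear combination is given only through its half width function.\<close>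

definition width_integral_fun :: "nat \<Rightarrow> (real ^ 'n \<Rightarrow> real) \<Rightarrow> real" where
  "width_integral_fun i b = 1 / CARD('n) * (LINT u|sphere_measure. b u ^ (CARD('n) - i))"

definition width_integral :: "nat \<Rightarrow> (real ^ 'n) set \<Rightarrow> real" where
  "width_integral i K = width_integral_fun i (half_width K)"

text \<open>The value at \<open>0\<close> and at \<open>\<infinity>\<close> is a limit; the real number \<open>\<phi> 0\<close> plays no role.\<close>

definition orlicz_class :: "(real \<Rightarrow> real) set" where
  "orlicz_class = {\<phi>. convex_on {0<..} \<phi> \<and> strict_antimono_on {0<..} \<phi> \<and> (\<forall>t>0. \<phi> t > 0) \<and>
     filterlim \<phi> at_top (at_right 0) \<and> \<phi> 1 = 1 \<and> (\<phi> \<longlongrightarrow> 0) at_top}"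

definition orlicz_half_width ::
  "(real \<Rightarrow> real) \<Rightarrow> (real \<Rightarrow> real) \<Rightarrow> (real ^ 'n) set \<Rightarrow> real \<Rightarrow> (real ^ 'n) set \<Rightarrow> real ^ 'n \<Rightarrow> real" where
  "orlicz_half_width \<phi>\<^sub>1 \<phi>\<^sub>2 K \<epsilon> L u =
     (THE b. b > 0 \<and> \<phi>\<^sub>1 (half_width K u / b) + \<epsilon> * \<phi>\<^sub>2 (half_width L u / b) = 1)"

definition orlicz_width_integral ::
  "nat \<Rightarrow> (real \<Rightarrow> real) \<Rightarrow> (real \<Rightarrow> real) \<Rightarrow> (real ^ 'n) set \<Rightarrow> real \<Rightarrow> (real ^ 'n) set \<Rightarrow> real" where
  "orlicz_width_integral i \<phi>\<^sub>1 \<phi>\<^sub>2 K \<epsilon> L = width_integral_fun i (orlicz_half_width \<phi>\<^sub>1 \<phi>\<^sub>2 K \<epsilon> L)"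

definition right_deriv :: "(real \<Rightarrow> real) \<Rightarrow> real \<Rightarrow> real" where
  "right_deriv f x = Lim (at_right x) (\<lambda>y. (f y - f x) / (y - x))"

end

theory Submission
  imports Defs
begin

text \<open>Write \<open>x = b(K, u)\<close>, \<open>y = b(L, u)\<close>, let \<open>b\<close> be the combined half width and \<open>t = x / b > 1\<close>. The
  defining equation reads \<open>(\<phi>\<^sub>1 t - \<phi>\<^sub>1 1) / (t - 1) * ((t - 1) / \<epsilon>) = - \<phi>\<^sub>2 (t * y / x)\<close>, so \<open>(t - 1) / \<epsilon>\<close>
  tends to \<open>- \<phi>\<^sub>2 (y / x)\<close> divided by the right derivative of \<open>\<phi>\<^sub>1\<close> at \<open>1\<close>, and the pointwise derivative
  of \<open>b ^ p = x ^ p / t ^ p\<close> follows. Comparing \<open>\<phi>\<^sub>1\<close> with its chord over \<open>[1, 2]\<close> bounds \<open>(t - 1) / \<epsilon>\<close>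
  uniformly in \<open>u\<close> for small \<open>\<epsilon>\<close>, which permits dominated convergence on the sphere.\<close>

section \<open>One-sided derivatives of convex functions\<close>

text \<open>Chord slopes issuing from \<open>x\<close> grow with the right endpoint, so their limit
  at \<open>x\<close> from the right is their infimum. The bound of \<open>l\<close> by every slope
  is kept in the conclusion because it yields the sign of the derivative later.\<close>

lemma convex_on_right_slope_tendsto:
  fixes f :: "real \<Rightarrow> real"
  assumes f: "convex_on {a<..} f" and x: "a < x"
  shows "\<exists>l. ((\<lambda>y. (f y - f x) / (y - x)) \<longlongrightarrow> l) (at_right x) \<and> (\<forall>y>x. l \<le> (f y - f x) / (y - x))"
proof -
  define s where "s y = (f y - f x) / (y - x)" for y
  have swap: "(f u - f v) / (u - v) = (f v - f u) / (v - u)" for u v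
    by (metis minus_diff_eq minus_divide_divide)
  have mono: "s y \<le> s z" if "x < y" "y < z" for y z
    using convex_on_slope_le(1)[OF f, of x z y] that x unfolding s_def
    by (simp add: swap[of x])
  \<comment> \<open>The open domain leaves room to the left of \<open>x\<close>. The slope of the
    chord from \<open>c\<close> to \<open>x\<close> lies below every \<open>s y\<close>, so the
    infimum defining \<open>l\<close> is finite.\<close>
  obtain c where c: "a < c" "c < x" using x dense by blast
  have lower: "(f c - f x) / (c - x) \<le> s y" if "x < y" for y
    using convex_on_slope_le[OF f, of c y x] that x c unfolding s_def
    by (simp add: swap[of x y])
  define l where "l = (INF y\<in>{x<..}. s y)"
  have bdd: "bdd_below (s ` {x<..})"
    using lower by (auto simp: bdd_below_def)
  have le: "l \<le> s y" if "x < y" for y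
    unfolding l_def using bdd that by (auto intro: cINF_lower)
  have "(s \<longlongrightarrow> l) (at_right x)"
  proof (rule order_tendstoI)
    fix b assume "b < l"
    show "eventually (\<lambda>y. b < s y) (at_right x)"
      using eventually_at_right_less[of x] by eventually_elim (rule less_le_trans[OF \<open>b < l\<close> le])
  next
    fix b assume "l < b"
    then obtain z where z: "z > x" "s z < b"
      unfolding l_def using bdd by (subst (asm) cINF_less_iff) auto
    show "eventually (\<lambda>y. s y < b) (at_right x)"
      using eventually_at_right_real[OF z(1)] by eventually_elim (use mono z(2) in \<open>fastforce intro: le_less_trans\<close>)
  qed
  with le show ?thesis unfolding s_def by blast
qed

section \<open>The scalar Orlicz equation\<close>

lemma orlicz_classD:
  assumes "\<phi> \<in> orlicz_class"
  shows orlicz_convex: "convex_on {0<..} \<phi>"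
    and orlicz_less: "0 < s \<Longrightarrow> s < t \<Longrightarrow> \<phi> t < \<phi> s"
    and orlicz_le: "0 < s \<Longrightarrow> s \<le> t \<Longrightarrow> \<phi> t \<le> \<phi> s"
    and orlicz_pos: "0 < t \<Longrightarrow> 0 < \<phi> t"
    and orlicz_one: "\<phi> 1 = 1"
    and orlicz_tendsto: "(\<phi> \<longlongrightarrow> 0) at_top"
    and orlicz_continuous: "continuous_on {0<..} \<phi>"
proof -
  show *: "convex_on {0<..} \<phi>" and "0 < t \<Longrightarrow> 0 < \<phi> t" and "\<phi> 1 = 1" and "(\<phi> \<longlongrightarrow> 0) at_top"
    using assms by (auto simp: orlicz_class_def)
  show less: "\<phi> t < \<phi> s" if "0 < s" "s < t" for s t
    using assms that by (auto simp: orlicz_class_def monotone_on_def)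
  show "0 < s \<Longrightarrow> s \<le> t \<Longrightarrow> \<phi> t \<le> \<phi> s"
    using less[of s t] by (cases "s = t") auto
  show "continuous_on {0<..} \<phi>"
    using * by (intro convex_on_continuous) auto
qed

text \<open>Uniqueness of limits at the nontrivial filter \<open>at_right 1\<close> identifies the
  \<open>Lim\<close> in \<open>right_deriv\<close> with the limit of the slopes. Being a lower bound
  of the slopes, it is at most the slope over [1, 2], which is negative by strict decrease.\<close>

lemma orlicz_right_deriv:
  assumes \<phi>: "\<phi> \<in> orlicz_class"
  shows "((\<lambda>t. (\<phi> t - \<phi> 1) / (t - 1)) \<longlongrightarrow> right_deriv \<phi> 1) (at_right 1)"
    and "right_deriv \<phi> 1 < 0"
proof -
  obtain l where l: "((\<lambda>t. (\<phi> t - \<phi> 1) / (t - 1)) \<longlongrightarrow> l) (at_right 1)"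
    and le: "\<And>t. t > 1 \<Longrightarrow> l \<le> (\<phi> t - \<phi> 1) / (t - 1)"
    using convex_on_right_slope_tendsto[OF orlicz_convex[OF \<phi>], of 1] by auto
  have eq: "right_deriv \<phi> 1 = l"
    unfolding right_deriv_def by (rule tendsto_Lim[OF _ l]) simp
  show "((\<lambda>t. (\<phi> t - \<phi> 1) / (t - 1)) \<longlongrightarrow> right_deriv \<phi> 1) (at_right 1)"
    using l eq by simp
  show "right_deriv \<phi> 1 < 0"
    using le[of 2] orlicz_less[OF \<phi>, of 1 2] eq by simp
qed

section \<open>Existence and uniqueness of the root for fixed positive half widths\<close>

locale orlicz_pair =
  fixes \<phi>\<^sub>1 \<phi>\<^sub>2 :: "real \<Rightarrow> real"
  assumes \<phi>\<^sub>1: "\<phi>\<^sub>1 \<in> orlicz_class" and \<phi>\<^sub>2: "\<phi>\<^sub>2 \<in> orlicz_class"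
begin

definition orlicz_sum :: "real \<Rightarrow> real \<Rightarrow> real \<Rightarrow> real \<Rightarrow> real" where
  "orlicz_sum x y \<epsilon> b = \<phi>\<^sub>1 (x / b) + \<epsilon> * \<phi>\<^sub>2 (y / b)"

text \<open>Scalar form of \<open>orlicz_half_width\<close>: the direction enters the equation only
  through the two half widths, so the analysis can be done for fixed numbers \<open>x\<close> and
  \<open>y\<close>.\<close>

definition orlicz_root :: "real \<Rightarrow> real \<Rightarrow> real \<Rightarrow> real" where
  "orlicz_root x y \<epsilon> = (THE b. b > 0 \<and> orlicz_sum x y \<epsilon> b = 1)"

lemma orlicz_sum_less:
  assumes "x > 0" "y > 0" "\<epsilon> > 0" "0 < b" "b < c"
  shows "orlicz_sum x y \<epsilon> b < orlicz_sum x y \<epsilon> c"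
  unfolding orlicz_sum_def using assms
  by (intro add_strict_mono mult_strict_left_mono orlicz_less[OF \<phi>\<^sub>1] orlicz_less[OF \<phi>\<^sub>2])
     (auto simp: divide_strict_left_mono)

lemma continuous_on_orlicz_sum:
  assumes "x > 0" "y > 0"
  shows "continuous_on {0<..} (orlicz_sum x y \<epsilon>)"
  unfolding orlicz_sum_def using assms
  by (intro continuous_intros continuous_on_compose2[OF orlicz_continuous[OF \<phi>\<^sub>1]]
      continuous_on_compose2[OF orlicz_continuous[OF \<phi>\<^sub>2]]) auto

lemma orlicz_sum_tendsto_0:
  assumes "x > 0" "y > 0"
  shows "(orlicz_sum x y \<epsilon> \<longlongrightarrow> 0) (at_right 0)"
proof -
  have *: "filterlim (\<lambda>b. z / b) at_top (at_right (0::real))" if "z > 0" for z :: real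
    unfolding divide_inverse
    by (rule filterlim_tendsto_pos_mult_at_top[OF tendsto_const that filterlim_inverse_at_top_right])
  have "((\<lambda>b. \<phi>\<^sub>1 (x / b) + \<epsilon> * \<phi>\<^sub>2 (y / b)) \<longlongrightarrow> 0 + \<epsilon> * 0) (at_right 0)"
    by (intro tendsto_intros filterlim_compose[OF orlicz_tendsto[OF \<phi>\<^sub>1] *[OF assms(1)]]
        filterlim_compose[OF orlicz_tendsto[OF \<phi>\<^sub>2] *[OF assms(2)]])
  then show ?thesis unfolding orlicz_sum_def by simp
qed

text \<open>The sum is continuous in \<open>b\<close>, tends to 0 as \<open>b\<close> decreases to
  0, and exceeds 1 at \<open>b = x\<close> because \<open>\<phi>\<^sub>1 1 = 1\<close> and the
  second term is positive. The intermediate value theorem gives a root, strict monotonicity makes it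
  unique, and the strict excess at \<open>x\<close> puts it below \<open>x\<close>.\<close>

lemma orlicz_root:
  assumes "x > 0" "y > 0" "\<epsilon> > 0"
  shows orlicz_root_pos: "orlicz_root x y \<epsilon> > 0" and orlicz_root_eq: "orlicz_sum x y \<epsilon> (orlicz_root x y \<epsilon>) = 1"
    and orlicz_root_less: "orlicz_root x y \<epsilon> < x"
proof -
  have Fx: "orlicz_sum x y \<epsilon> x > 1"
    using assms orlicz_one[OF \<phi>\<^sub>1] orlicz_pos[OF \<phi>\<^sub>2, of "y / x"] by (simp add: orlicz_sum_def)
  have "eventually (\<lambda>b. orlicz_sum x y \<epsilon> b < 1) (at_right 0)"
    using orlicz_sum_tendsto_0[OF assms(1,2)] by (rule order_tendstoD) simp
  moreover have "eventually (\<lambda>b. b \<in> {0<..<x}) (at_right 0)"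
    using assms(1) by (rule eventually_at_right_real)
  ultimately have "eventually (\<lambda>b. orlicz_sum x y \<epsilon> b < 1 \<and> b \<in> {0<..<x}) (at_right 0)"
    by (rule eventually_conj)
  then obtain c where c: "0 < c" "c < x" "orlicz_sum x y \<epsilon> c < 1"
    using eventually_happens'[of "at_right (0::real)"] by auto
  have "continuous_on {c..x} (orlicz_sum x y \<epsilon>)"
    using continuous_on_orlicz_sum[OF assms(1,2)] by (rule continuous_on_subset) (use c in auto)
  then obtain b where b: "c \<le> b" "b \<le> x" "orlicz_sum x y \<epsilon> b = 1"
    using IVT'[of "orlicz_sum x y \<epsilon>" c 1 x] c Fx by auto
  have "d = b" if "d > 0" "orlicz_sum x y \<epsilon> d = 1" for d
    using orlicz_sum_less[OF assms, of d b] orlicz_sum_less[OF assms, of b d] b c that by (cases d b rule: linorder_cases) auto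
  then have "orlicz_root x y \<epsilon> = b"
    unfolding orlicz_root_def using b c by (intro the_equality) auto
  moreover have "b \<noteq> x" using Fx b by auto
  ultimately show "orlicz_root x y \<epsilon> > 0" "orlicz_sum x y \<epsilon> (orlicz_root x y \<epsilon>) = 1" "orlicz_root x y \<epsilon> < x"
    using b c by auto
qed

text \<open>Follows from strict monotonicity of the sum in \<open>b\<close>. It describes superlevel
  sets of the root without the description operator, as needed for measurability.\<close>

lemma less_orlicz_root_iff:
  assumes "x > 0" "y > 0" "\<epsilon> > 0" "c > 0"
  shows "c < orlicz_root x y \<epsilon> \<longleftrightarrow> orlicz_sum x y \<epsilon> c < 1"
  using orlicz_sum_less[OF assms(1-3), of c "orlicz_root x y \<epsilon>"] orlicz_sum_less[OF assms(1-3), of "orlicz_root x y \<epsilon>" c]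
    orlicz_root[OF assms(1-3)] assms(4)
  by (cases c "orlicz_root x y \<epsilon>" rule: linorder_cases) auto

section \<open>The ratio of \<open>x\<close> to the root, and the difference quotient of powers of
  the root\<close>

lemma orlicz_root_ratio:
  assumes "x > 0" "y > 0" "\<epsilon> > 0"
  shows "x / orlicz_root x y \<epsilon> > 1"
    and "\<phi>\<^sub>1 (x / orlicz_root x y \<epsilon>) - 1 = - \<epsilon> * \<phi>\<^sub>2 (y / x * (x / orlicz_root x y \<epsilon>))"
    and "orlicz_root x y \<epsilon> = x / (x / orlicz_root x y \<epsilon>)"
  using orlicz_root[OF assms] assms unfolding orlicz_sum_def by (auto simp: field_simps)

text \<open>As \<open>t > 1\<close> and \<open>\<phi>\<^sub>2\<close> decreases, the equation gives
  \<open>1 - \<phi>\<^sub>1 t \<le> \<epsilon> * \<phi>\<^sub>2 (y / x)\<close>. The smallness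
  assumption then forces \<open>t < 2\<close>, so that the chord of \<open>\<phi>\<^sub>1\<close>
  over [1, 2] is available at \<open>t\<close>.\<close>

lemma orlicz_root_ratio_bound:
  assumes "x > 0" "y > 0" "\<epsilon> > 0" and small: "\<epsilon> * \<phi>\<^sub>2 (y / x) < 1 - \<phi>\<^sub>1 2"
  shows "(x / orlicz_root x y \<epsilon> - 1) * (1 - \<phi>\<^sub>1 2) \<le> \<epsilon> * \<phi>\<^sub>2 (y / x)"
proof -
  define t where "t = x / orlicz_root x y \<epsilon>"
  have t: "t > 1" "\<phi>\<^sub>1 t - 1 = - \<epsilon> * \<phi>\<^sub>2 (y / x * t)"
    unfolding t_def using orlicz_root_ratio[OF assms(1-3)] by auto
  have "y / x * 1 \<le> y / x * t"
    using assms t(1) by (intro mult_left_mono) auto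
  then have "\<phi>\<^sub>2 (y / x * t) \<le> \<phi>\<^sub>2 (y / x)"
    using assms by (intro orlicz_le[OF \<phi>\<^sub>2]) auto
  then have "\<epsilon> * \<phi>\<^sub>2 (y / x * t) \<le> \<epsilon> * \<phi>\<^sub>2 (y / x)"
    using assms(3) by (intro mult_left_mono) auto
  with t(2) have le: "1 - \<phi>\<^sub>1 t \<le> \<epsilon> * \<phi>\<^sub>2 (y / x)" by linarith
  have "t < 2"
  proof (rule ccontr)
    assume "\<not> t < 2"
    then have "\<phi>\<^sub>1 t \<le> \<phi>\<^sub>1 2" by (intro orlicz_le[OF \<phi>\<^sub>1]) auto
    with le small show False by linarith
  qed
  have "convex_on {1..2} \<phi>\<^sub>1"
    using orlicz_convex[OF \<phi>\<^sub>1] by (rule convex_on_subset) auto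
  from convex_onD_Icc'[OF this, of t] t(1) \<open>t < 2\<close> orlicz_one[OF \<phi>\<^sub>1]
  have "\<phi>\<^sub>1 t \<le> (\<phi>\<^sub>1 2 - 1) * (t - 1) + 1" by simp
  then have "(t - 1) * (1 - \<phi>\<^sub>1 2) \<le> 1 - \<phi>\<^sub>1 t" by (simp add: algebra_simps)
  then show ?thesis using le unfolding t_def by (rule order_trans)
qed

lemma chord_pos: "1 - \<phi>\<^sub>1 2 > 0"
  using orlicz_less[OF \<phi>\<^sub>1, of 1 2] orlicz_one[OF \<phi>\<^sub>1] by simp

text \<open>Bernoulli's inequality bounds \<open>1 - (1 / t) ^ p\<close> by
  \<open>p * (1 - 1 / t)\<close>, and \<open>1 - 1 / t \<le> t - 1\<close> reduces this to the ratio
  bound. The resulting bound is free of \<epsilon>, so it can serve for domination.\<close>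

lemma orlicz_root_power_bound:
  assumes "x > 0" "y > 0" "\<epsilon> > 0" and "\<epsilon> * \<phi>\<^sub>2 (y / x) < 1 - \<phi>\<^sub>1 2"
  shows "\<bar>(orlicz_root x y \<epsilon> ^ p - x ^ p) / \<epsilon>\<bar> \<le> x ^ p * p * (\<phi>\<^sub>2 (y / x) / (1 - \<phi>\<^sub>1 2))"
proof -
  define t where "t = x / orlicz_root x y \<epsilon>"
  have t: "t > 1" "orlicz_root x y \<epsilon> = x * (1 / t)"
    unfolding t_def using orlicz_root_ratio[OF assms(1-3)] by auto
  have bern: "1 + real p * (1 / t - 1) \<le> (1 / t) ^ p"
    using Bernoulli_inequality[of "1 / t - 1" p] t(1) by simp
  have "1 - 1 / t \<le> t - 1"
  proof -
    have "t * t - 2 * t + 1 \<ge> 0" using zero_le_power2[of "t - 1"] by (simp add: power2_eq_square algebra_simps)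
    then show ?thesis using t(1) by (simp add: field_simps)
  qed
  also have "t - 1 \<le> \<epsilon> * \<phi>\<^sub>2 (y / x) / (1 - \<phi>\<^sub>1 2)"
    using orlicz_root_ratio_bound[OF assms] chord_pos unfolding t_def by (simp add: pos_le_divide_eq)
  finally have "real p * (1 - 1 / t) \<le> real p * (\<epsilon> * \<phi>\<^sub>2 (y / x) / (1 - \<phi>\<^sub>1 2))"
    by (rule mult_left_mono) simp
  with bern have "1 - (1 / t) ^ p \<le> real p * (\<epsilon> * \<phi>\<^sub>2 (y / x) / (1 - \<phi>\<^sub>1 2))"
    by (simp add: algebra_simps)
  then have "x ^ p * (1 - (1 / t) ^ p) \<le> x ^ p * (real p * (\<epsilon> * \<phi>\<^sub>2 (y / x) / (1 - \<phi>\<^sub>1 2)))"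
    using assms(1) by (intro mult_left_mono) auto
  then have "x ^ p - orlicz_root x y \<epsilon> ^ p \<le> x ^ p * p * (\<phi>\<^sub>2 (y / x) / (1 - \<phi>\<^sub>1 2)) * \<epsilon>"
    unfolding t(2) power_mult_distrib by (simp add: algebra_simps)
  \<comment> \<open>This fixes the sign of the difference, so the one-sided estimate above already
    controls the absolute value.\<close>
  moreover have "orlicz_root x y \<epsilon> ^ p \<le> x ^ p"
    using orlicz_root[OF assms(1-3)] by (intro power_mono) auto
  ultimately show ?thesis
    using assms(3) by (simp add: abs_divide pos_divide_le_eq)
qed

lemma orlicz_root_power_deriv:
  assumes "x > 0" "y > 0"
  shows "((\<lambda>\<epsilon>. (orlicz_root x y \<epsilon> ^ p - x ^ p) / \<epsilon>) \<longlongrightarrow> p * (\<phi>\<^sub>2 (y / x) * x ^ p) / right_deriv \<phi>\<^sub>1 1) (at_right 0)"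
proof -
  define T where "T \<epsilon> = x / orlicz_root x y \<epsilon>" for \<epsilon>
  define C where "C = \<phi>\<^sub>2 (y / x) / (1 - \<phi>\<^sub>1 2)"
  define r where "r = right_deriv \<phi>\<^sub>1 1"
  have pos: "eventually (\<lambda>\<epsilon>. \<epsilon> > 0) (at_right (0::real))"
    by (rule eventually_at_right_less)
  have "((\<lambda>\<epsilon>. \<epsilon> * \<phi>\<^sub>2 (y / x)) \<longlongrightarrow> 0 * \<phi>\<^sub>2 (y / x)) (at_right 0)"
    by (intro tendsto_intros)
  then have small: "eventually (\<lambda>\<epsilon>. \<epsilon> * \<phi>\<^sub>2 (y / x) < 1 - \<phi>\<^sub>1 2) (at_right 0)"
    by (rule order_tendstoD) (use chord_pos in simp)
  have T_gt: "eventually (\<lambda>\<epsilon>. T \<epsilon> > 1) (at_right 0)"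
    using pos by eventually_elim (use orlicz_root_ratio(1)[OF assms] in \<open>simp add: T_def\<close>)
  have T_le: "eventually (\<lambda>\<epsilon>. T \<epsilon> \<le> 1 + C * \<epsilon>) (at_right 0)"
    using pos small
  proof eventually_elim
    case (elim \<epsilon>)
    then have "T \<epsilon> - 1 \<le> \<epsilon> * \<phi>\<^sub>2 (y / x) / (1 - \<phi>\<^sub>1 2)"
      using orlicz_root_ratio_bound[OF assms] chord_pos unfolding T_def by (simp add: pos_le_divide_eq)
    then show ?case by (simp add: C_def mult.commute)
  qed
  have "((\<lambda>\<epsilon>. 1 + C * \<epsilon>) \<longlongrightarrow> 1 + C * 0) (at_right 0)" by (intro tendsto_intros)
  then have T1: "(T \<longlongrightarrow> 1) (at_right 0)"
    using T_gt T_le by (intro tendsto_sandwich[of "\<lambda>_. 1" T _ "\<lambda>\<epsilon>. 1 + C * \<epsilon>"])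
      (auto elim: eventually_mono)
  \<comment> \<open>\<open>T\<close> approaches 1 from strictly above, which matters because only
    the right derivative of \<open>\<phi>\<^sub>1\<close> at 1 is at hand.\<close>
  have T: "filterlim T (at_right 1) (at_right 0)"
    using T1 T_gt unfolding filterlim_at by (auto elim: eventually_mono)
  have slope: "((\<lambda>\<epsilon>. (\<phi>\<^sub>1 (T \<epsilon>) - \<phi>\<^sub>1 1) / (T \<epsilon> - 1)) \<longlongrightarrow> r) (at_right 0)"
    unfolding r_def by (rule filterlim_compose[OF orlicz_right_deriv(1)[OF \<phi>\<^sub>1] T])
  have "isCont \<phi>\<^sub>2 (y / x)"
    using orlicz_continuous[OF \<phi>\<^sub>2] assms by (subst (asm) continuous_on_eq_continuous_at) auto
  moreover have "((\<lambda>\<epsilon>. y / x * T \<epsilon>) \<longlongrightarrow> y / x) (at_right 0)"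
    using tendsto_mult_left[OF T1, of "y / x"] by simp
  ultimately have num: "((\<lambda>\<epsilon>. \<phi>\<^sub>2 (y / x * T \<epsilon>)) \<longlongrightarrow> \<phi>\<^sub>2 (y / x)) (at_right 0)"
    by (rule isCont_tendsto_compose)
  have "((\<lambda>t::real. inverse t ^ p) has_real_derivative - real p) (at 1)"
    by (auto intro!: derivative_eq_intros)
  then have "((\<lambda>t::real. (inverse t ^ p - 1) / (t - 1)) \<longlongrightarrow> - real p) (at_right 1)"
    unfolding has_field_derivative_iff by (simp add: filterlim_at_split)
  then have pw: "((\<lambda>\<epsilon>. (inverse (T \<epsilon>) ^ p - 1) / (T \<epsilon> - 1)) \<longlongrightarrow> - real p) (at_right 0)"
    by (rule filterlim_compose[OF _ T])
  have r0: "r \<noteq> 0" using orlicz_right_deriv(2)[OF \<phi>\<^sub>1] r_def by simp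
  \<comment> \<open>The equation is used to eliminate \<epsilon>: the quotient becomes the slope of
    \<open>inverse t ^ p\<close> at 1, divided by the slope of \<open>\<phi>\<^sub>1\<close> at 1
    and multiplied by \<open>- \<phi>\<^sub>2 (y / x * T \<epsilon>)\<close>. Each factor has a
    limit, and the limit of the denominator is nonzero.\<close>
  have lim: "((\<lambda>\<epsilon>. x ^ p * ((inverse (T \<epsilon>) ^ p - 1) / (T \<epsilon> - 1)) *
      (- \<phi>\<^sub>2 (y / x * T \<epsilon>) / ((\<phi>\<^sub>1 (T \<epsilon>) - \<phi>\<^sub>1 1) / (T \<epsilon> - 1)))) \<longlongrightarrow>
      x ^ p * (- real p) * (- \<phi>\<^sub>2 (y / x) / r)) (at_right 0)"
    by (intro tendsto_intros pw num slope r0)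
  have eq: "eventually (\<lambda>\<epsilon>. x ^ p * ((inverse (T \<epsilon>) ^ p - 1) / (T \<epsilon> - 1)) *
      (- \<phi>\<^sub>2 (y / x * T \<epsilon>) / ((\<phi>\<^sub>1 (T \<epsilon>) - \<phi>\<^sub>1 1) / (T \<epsilon> - 1))) = (orlicz_root x y \<epsilon> ^ p - x ^ p) / \<epsilon>) (at_right 0)"
    using pos
  proof eventually_elim
    case (elim \<epsilon>)
    note rr = orlicz_root_ratio[OF assms elim, folded T_def]
    have w: "\<phi>\<^sub>2 (y / x * T \<epsilon>) > 0" using rr(1) assms by (intro orlicz_pos[OF \<phi>\<^sub>2]) auto
    have diff: "\<phi>\<^sub>1 (T \<epsilon>) - \<phi>\<^sub>1 1 = - \<epsilon> * \<phi>\<^sub>2 (y / x * T \<epsilon>)"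
      using rr(2) orlicz_one[OF \<phi>\<^sub>1] by simp
    have power: "orlicz_root x y \<epsilon> ^ p = x ^ p * inverse (T \<epsilon>) ^ p"
      by (subst rr(3)) (simp add: divide_inverse power_mult_distrib)
    have cancel: "a * (z / d) * (- w / (- \<epsilon> * w / d)) = a * z / \<epsilon>" if "w > 0" "d > 0" for a z d w :: real
      using that elim by (simp add: field_simps)
    show ?case
      unfolding diff power by (subst cancel[OF w]) (use rr(1) in \<open>simp_all add: right_diff_distrib\<close>)
  qed
  show ?thesis
    using Lim_transform_eventually[OF lim eq] unfolding r_def by (simp add: mult_ac)
qed

end

section \<open>Half widths and the surface measure\<close>

text \<open>The cone over the whole sphere lies in the unit ball, which has finite Lebesgue
  measure.\<close>

lemma finite_measure_sphere: "finite_measure (sphere_measure :: (real ^ 'n) measure)"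
proof (rule finite_measureI)
  have "emeasure lborel {t *\<^sub>R u | t u. 0 < t \<and> t < 1 \<and> u \<in> sphere (0 :: real ^ 'n) 1}
      \<le> emeasure lborel (ball (0 :: real ^ 'n) 1)"
    by (intro emeasure_mono) auto
  also have "\<dots> < \<infinity>" by (rule emeasure_lborel_ball_finite)
  finally show "emeasure sphere_measure (space (sphere_measure :: (real ^ 'n) measure)) \<noteq> \<infinity>"
    by (simp add: emeasure_sphere_measure ennreal_mult_eq_top_iff)
qed

lemma borel_measurable_sphere_measure_eq:
  "borel_measurable sphere_measure = borel_measurable (restrict_space borel (sphere (0 :: real ^ 'n) 1))"
  by (intro measurable_cong_sets sets_sphere_measure refl)

lemma bdd_above_inner_image:
  assumes "compact (K :: (real ^ 'n) set)"
  shows "bdd_above ((\<lambda>y. x \<bullet> y) ` K)"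
  by (intro bounded_imp_bdd_above compact_imp_bounded compact_continuous_image assms continuous_intros)

text \<open>A supremum of linear functionals is convex, and a real-valued convex function on a whole
  Euclidean space is continuous. Compactness and nonemptiness make the supremum a genuine
  one.\<close>

lemma continuous_on_support_fun:
  fixes K :: "(real ^ 'n) set"
  assumes K: "compact K" "K \<noteq> {}"
  shows "continuous_on UNIV (support_fun K)"
proof (rule convex_on_continuous)
  show "convex_on UNIV (support_fun K)"
  proof (rule convex_onI)
    fix t :: real and x y :: "real ^ 'n"
    assume t: "0 < t" "t < 1"
    have le: "v \<bullet> z \<le> support_fun K v" if "z \<in> K" for v z
      unfolding support_fun_def by (intro cSUP_upper that bdd_above_inner_image K)
    show "support_fun K ((1 - t) *\<^sub>R x + t *\<^sub>R y) \<le> (1 - t) * support_fun K x + t * support_fun K y"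
      unfolding support_fun_def[of K "(1 - t) *\<^sub>R x + t *\<^sub>R y"]
    proof (rule cSUP_least[OF K(2)])
      fix z assume "z \<in> K"
      then show "((1 - t) *\<^sub>R x + t *\<^sub>R y) \<bullet> z \<le> (1 - t) * support_fun K x + t * support_fun K y"
        using t le[of z] by (auto simp: inner_add_left intro!: add_mono mult_left_mono)
    qed
  qed simp
qed simp

text \<open>A ball around the origin inside \<open>K\<close> contains a positive multiple of
  \<open>u\<close>, whose inner product with \<open>u\<close> is positive.\<close>

lemma support_fun_pos:
  fixes K :: "(real ^ 'n) set"
  assumes "compact K" "0 \<in> interior K" "u \<noteq> 0"
  shows "support_fun K u > 0"
proof -
  obtain r where r: "r > 0" "cball 0 r \<subseteq> K"
    using assms(2) unfolding mem_interior_cball by auto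
  have "(r / norm u) *\<^sub>R u \<in> K" using r assms(3) by auto
  then have "u \<bullet> ((r / norm u) *\<^sub>R u) \<le> support_fun K u"
    unfolding support_fun_def by (intro cSUP_upper bdd_above_inner_image assms)
  moreover have "u \<bullet> ((r / norm u) *\<^sub>R u) > 0" using r assms(3) by simp
  ultimately show ?thesis by linarith
qed

text \<open>Extreme values are attained on the compact sphere and the minimum is positive. These
  uniform bounds supply the constants for dominated convergence.\<close>

lemma half_width_bounds:
  fixes K :: "(real ^ 'n) set"
  assumes "K \<in> convex_bodies"
  shows "continuous_on (sphere 0 1) (half_width K)"
    and "\<exists>m M. 0 < m \<and> (\<forall>u\<in>sphere 0 1. m \<le> half_width K u \<and> half_width K u \<le> M)"
proof -
  have K: "compact K" "0 \<in> interior K" "K \<noteq> {}"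
    using assms interior_subset by (auto simp: convex_bodies_def)
  note h = continuous_on_support_fun[OF K(1,3)]
  have "continuous_on UNIV (half_width K)"
    unfolding half_width_def
    by (intro continuous_intros h continuous_on_compose2[OF h]) auto
  then show cont: "continuous_on (sphere 0 1) (half_width K)"
    by (rule continuous_on_subset) simp
  have pos: "half_width K u > 0" if "u \<in> sphere 0 1" for u
  proof -
    have "u \<noteq> 0" using that by auto
    then show ?thesis
      using support_fun_pos[OF K(1,2), of u] support_fun_pos[OF K(1,2), of "- u"]
      by (simp add: half_width_def)
  qed
  have ne: "sphere (0 :: real ^ 'n) 1 \<noteq> {}" by simp
  obtain u v where "u \<in> sphere 0 1" "\<forall>w\<in>sphere 0 1. half_width K u \<le> half_width K w"
    and "\<forall>w\<in>sphere 0 1. half_width K w \<le> half_width K v"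
    using continuous_attains_inf[OF compact_sphere ne cont]
      continuous_attains_sup[OF compact_sphere ne cont] by blast
  then show "\<exists>m M. 0 < m \<and> (\<forall>u\<in>sphere 0 1. m \<le> half_width K u \<and> half_width K u \<le> M)"
    using pos by blast
qed

lemma measurable_half_width:
  fixes K :: "(real ^ 'n) set"
  assumes "K \<in> convex_bodies"
  shows "half_width K \<in> borel_measurable sphere_measure"
  unfolding borel_measurable_sphere_measure_eq
  using half_width_bounds(1)[OF assms] by (rule borel_measurable_continuous_on_restrict)

section \<open>Measurability in the direction and differentiation under the integral\<close>

context orlicz_pair
begin

lemma orlicz_half_width_eq_orlicz_root:
  "orlicz_half_width \<phi>\<^sub>1 \<phi>\<^sub>2 K \<epsilon> L = (\<lambda>u. orlicz_root (half_width K u) (half_width L u) \<epsilon>)"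
  by (simp add: fun_eq_iff orlicz_half_width_def orlicz_root_def orlicz_sum_def)

lemma measurable_orlicz_root:
  assumes f [measurable]: "f \<in> borel_measurable M" and g [measurable]: "g \<in> borel_measurable M"
    and pos: "\<And>u. u \<in> space M \<Longrightarrow> f u > 0" "\<And>u. u \<in> space M \<Longrightarrow> g u > 0" and "\<epsilon> > 0"
  shows "(\<lambda>u. orlicz_root (f u) (g u) \<epsilon>) \<in> borel_measurable M"
  unfolding borel_measurable_iff_greater
proof
  fix c :: real
  \<comment> \<open>Continuity of \<phi> is known only on the positive reals, so the composition
    passes through the restricted Borel space.\<close>
  have comp: "(\<lambda>u. \<phi> (h u / c)) \<in> borel_measurable M"
    if c: "c > 0" and \<phi>: "\<phi> \<in> orlicz_class" and [measurable]: "h \<in> borel_measurable M"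
      and h: "\<And>u. u \<in> space M \<Longrightarrow> h u > 0" for \<phi> h
  proof -
    have "(\<lambda>u. h u / c) \<in> M \<rightarrow>\<^sub>M restrict_space borel {0<..}"
      using c h by (intro measurable_restrict_space2) auto
    moreover have "\<phi> \<in> borel_measurable (restrict_space borel {0<..})"
      using orlicz_continuous[OF \<phi>] by (rule borel_measurable_continuous_on_restrict)
    ultimately show ?thesis by (rule measurable_compose)
  qed
  show "{u \<in> space M. c < orlicz_root (f u) (g u) \<epsilon>} \<in> sets M"
  proof (cases "c > 0")
    case True
    have [measurable]: "(\<lambda>u. \<phi>\<^sub>1 (f u / c)) \<in> borel_measurable M" "(\<lambda>u. \<phi>\<^sub>2 (g u / c)) \<in> borel_measurable M"
      using comp[OF True] \<phi>\<^sub>1 \<phi>\<^sub>2 f g pos by auto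
    have "{u \<in> space M. c < orlicz_root (f u) (g u) \<epsilon>} = {u \<in> space M. \<phi>\<^sub>1 (f u / c) + \<epsilon> * \<phi>\<^sub>2 (g u / c) < 1}"
      using less_orlicz_root_iff[OF pos \<open>\<epsilon> > 0\<close> True] by (auto simp: orlicz_sum_def)
    then show ?thesis by simp
  next
    case False
    \<comment> \<open>For \<open>c \<le> 0\<close> the superlevel set is the whole space, since
      roots are positive.\<close>
    have "c < orlicz_root (f u) (g u) \<epsilon>" if "u \<in> space M" for u
      using orlicz_root_pos[OF pos(1)[OF that] pos(2)[OF that] \<open>\<epsilon> > 0\<close>] False by simp
    then have "{u \<in> space M. c < orlicz_root (f u) (g u) \<epsilon>} = space M" by auto
    then show ?thesis by simp
  qed
qed

lemma width_power_deriv: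
  fixes K L :: "(real ^ 'n) set"
  assumes K: "K \<in> convex_bodies" and L: "L \<in> convex_bodies"
  defines "I f \<equiv> LINT u|(sphere_measure :: (real ^ 'n) measure). f u"
  shows "((\<lambda>\<epsilon>. (I (\<lambda>u. orlicz_root (half_width K u) (half_width L u) \<epsilon> ^ p) - I (\<lambda>u. half_width K u ^ p)) / \<epsilon>) \<longlongrightarrow>
    p / right_deriv \<phi>\<^sub>1 1 * I (\<lambda>u. \<phi>\<^sub>2 (half_width L u / half_width K u) * half_width K u ^ p)) (at_right 0)"
proof -
  let ?S = "sphere_measure :: (real ^ 'n) measure"
  interpret finite_measure ?S by (rule finite_measure_sphere)
  let ?x = "half_width K" and ?y = "half_width L"
  obtain m M where K': "0 < m" "\<And>u. u \<in> sphere 0 1 \<Longrightarrow> m \<le> ?x u" "\<And>u. u \<in> sphere 0 1 \<Longrightarrow> ?x u \<le> M"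
    using half_width_bounds(2)[OF K] by blast
  obtain m' where L': "0 < m'" "\<And>u. u \<in> sphere 0 1 \<Longrightarrow> m' \<le> ?y u"
    using half_width_bounds(2)[OF L] by blast
  have x: "?x u > 0" and y: "?y u > 0" if "u \<in> sphere 0 1" for u
    using K'(2)[OF that] L'(2)[OF that] K'(1) L'(1) by auto
  note [measurable] = measurable_half_width[OF K] measurable_half_width[OF L]
  have [measurable]: "(\<lambda>u. orlicz_root (?x u) (?y u) \<epsilon>) \<in> borel_measurable ?S" if "\<epsilon> > 0" for \<epsilon>
    using that x y by (intro measurable_orlicz_root) auto
  \<comment> \<open>Any point of the sphere will do: it shows that the upper bound \<open>M\<close>
    exceeds a positive half width.\<close>
  have "(axis (undefined :: 'n) 1 :: real ^ 'n) \<in> sphere 0 1" by (simp add: norm_axis_1)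
  then have M: "M > 0" using x K'(3) by fastforce
  \<comment> \<open>Since \<open>\<phi>\<^sub>2\<close> decreases, its value at the least
    \<open>?y\<close> bound over the greatest \<open>?x\<close> bound dominates
    \<open>\<phi>\<^sub>2 (?y u / ?x u)\<close> for all directions at once.\<close>
  define c where "c = \<phi>\<^sub>2 (m' / M)"
  have c: "c > 0" unfolding c_def using L' M by (intro orlicz_pos[OF \<phi>\<^sub>2]) auto
  have le_c: "\<phi>\<^sub>2 (?y u / ?x u) \<le> c" if "u \<in> sphere 0 1" for u
    unfolding c_def using L' M K'(3)[OF that] L'(2)[OF that] x[OF that]
    by (intro orlicz_le[OF \<phi>\<^sub>2] frac_le) auto
  have "\<phi>\<^sub>2 \<in> borel_measurable (restrict_space borel {0<..})"
    using orlicz_continuous[OF \<phi>\<^sub>2] by (rule borel_measurable_continuous_on_restrict)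
  moreover have "(\<lambda>u. ?y u / ?x u) \<in> ?S \<rightarrow>\<^sub>M restrict_space borel {0<..}"
    using x y by (intro measurable_restrict_space2) auto
  ultimately have [measurable]: "(\<lambda>u. \<phi>\<^sub>2 (?y u / ?x u)) \<in> borel_measurable ?S"
    by (rule measurable_compose_rev)
  have int_x: "integrable ?S (\<lambda>u. ?x u ^ p)"
    using K'(3) x by (intro integrable_const_bound[of _ "M ^ p"] AE_I2) (auto intro: power_mono simp: less_imp_le)
  \<comment> \<open>The root lies between 0 and \<open>?x u\<close>, so its powers are bounded by
    \<open>M ^ p\<close> on a finite measure space.\<close>
  have int_root: "integrable ?S (\<lambda>u. orlicz_root (?x u) (?y u) \<epsilon> ^ p)" if \<epsilon>: "\<epsilon> > 0" for \<epsilon>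
  proof (intro integrable_const_bound[of _ "M ^ p"] AE_I2)
    show "norm (orlicz_root (?x u) (?y u) \<epsilon> ^ p) \<le> M ^ p" if "u \<in> space ?S" for u
      using that orlicz_root_pos[OF x y \<epsilon>, of u u] orlicz_root_less[OF x y \<epsilon>, of u u] K'(3)[of u]
      by (auto intro!: power_mono simp: less_imp_le)
  qed (use \<epsilon> in measurable)
  have "((\<lambda>\<epsilon>. I (\<lambda>u. (orlicz_root (?x u) (?y u) \<epsilon> ^ p - ?x u ^ p) / \<epsilon>)) \<longlongrightarrow>
    I (\<lambda>u. p * (\<phi>\<^sub>2 (?y u / ?x u) * ?x u ^ p) / right_deriv \<phi>\<^sub>1 1)) (at_right 0)"
  proof (rule tendsto_at_right_sequentially)
    \<comment> \<open>Dominated convergence is applied along sequences decreasing or not to 0 from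
      the right. Below this threshold the smallness condition of
      \<open>orlicz_root_power_bound\<close> holds simultaneously for all directions.\<close>
    show "0 < (1 - \<phi>\<^sub>1 2) / c" using chord_pos c by simp
    fix e :: "nat \<Rightarrow> real"
    assume e: "\<And>n. 0 < e n" "\<And>n. e n < (1 - \<phi>\<^sub>1 2) / c" "e \<longlonglongrightarrow> 0"
    show "(\<lambda>n. I (\<lambda>u. (orlicz_root (?x u) (?y u) (e n) ^ p - ?x u ^ p) / e n)) \<longlonglongrightarrow>
      I (\<lambda>u. p * (\<phi>\<^sub>2 (?y u / ?x u) * ?x u ^ p) / right_deriv \<phi>\<^sub>1 1)"
      unfolding I_def
    proof (rule integral_dominated_convergence[where w = "\<lambda>_. M ^ p * p * (c / (1 - \<phi>\<^sub>1 2))"])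
      show "AE u in ?S. (\<lambda>n. (orlicz_root (?x u) (?y u) (e n) ^ p - ?x u ^ p) / e n) \<longlonglongrightarrow>
        p * (\<phi>\<^sub>2 (?y u / ?x u) * ?x u ^ p) / right_deriv \<phi>\<^sub>1 1"
      proof (rule AE_I2)
        fix u assume "u \<in> space ?S"
        then have u: "u \<in> sphere 0 1" by simp
        have "e n \<noteq> 0" for n using e(1)[of n] by simp
        then have "filterlim e (at_right 0) sequentially"
          using e by (auto simp: filterlim_at)
        from filterlim_compose[OF orlicz_root_power_deriv[OF x[OF u] y[OF u]] this]
        show "(\<lambda>n. (orlicz_root (?x u) (?y u) (e n) ^ p - ?x u ^ p) / e n) \<longlonglongrightarrow>
          p * (\<phi>\<^sub>2 (?y u / ?x u) * ?x u ^ p) / right_deriv \<phi>\<^sub>1 1" .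
      qed
      fix n
      show "(\<lambda>u. (orlicz_root (?x u) (?y u) (e n) ^ p - ?x u ^ p) / e n) \<in> borel_measurable ?S"
        using e(1) by measurable
      show "AE u in ?S. norm ((orlicz_root (?x u) (?y u) (e n) ^ p - ?x u ^ p) / e n) \<le> M ^ p * p * (c / (1 - \<phi>\<^sub>1 2))"
      proof (rule AE_I2)
        fix u assume "u \<in> space ?S"
        then have u: "u \<in> sphere 0 1" by simp
        have "e n * \<phi>\<^sub>2 (?y u / ?x u) \<le> e n * c"
          using le_c[OF u] e(1)[of n] by (intro mult_left_mono) auto
        also have "\<dots> < 1 - \<phi>\<^sub>1 2" using e(2)[of n] c by (simp add: pos_less_divide_eq)
        finally have "\<bar>(orlicz_root (?x u) (?y u) (e n) ^ p - ?x u ^ p) / e n\<bar>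
            \<le> ?x u ^ p * p * (\<phi>\<^sub>2 (?y u / ?x u) / (1 - \<phi>\<^sub>1 2))"
          by (rule orlicz_root_power_bound[OF x[OF u] y[OF u] e(1)])
        also have "\<dots> \<le> M ^ p * p * (c / (1 - \<phi>\<^sub>1 2))"
          using K'(3)[OF u] x[OF u] y[OF u] M le_c[OF u] chord_pos orlicz_pos[OF \<phi>\<^sub>2, of "?y u / ?x u"]
          by (intro mult_mono power_mono divide_right_mono) (auto simp: less_imp_le)
        finally show "norm ((orlicz_root (?x u) (?y u) (e n) ^ p - ?x u ^ p) / e n) \<le> M ^ p * p * (c / (1 - \<phi>\<^sub>1 2))"
          by simp
      qed
    qed simp_all
  qed
  \<comment> \<open>Splitting the integral of the difference needs integrability of both terms,
    which for the root is available when \<epsilon> is positive.\<close>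
  moreover have "eventually (\<lambda>\<epsilon>. I (\<lambda>u. (orlicz_root (?x u) (?y u) \<epsilon> ^ p - ?x u ^ p) / \<epsilon>) =
      (I (\<lambda>u. orlicz_root (?x u) (?y u) \<epsilon> ^ p) - I (\<lambda>u. ?x u ^ p)) / \<epsilon>) (at_right 0)"
    using eventually_at_right_less[of "0::real"]
    by eventually_elim (simp add: I_def int_root int_x)
  ultimately have "((\<lambda>\<epsilon>. (I (\<lambda>u. orlicz_root (?x u) (?y u) \<epsilon> ^ p) - I (\<lambda>u. ?x u ^ p)) / \<epsilon>) \<longlongrightarrow>
    I (\<lambda>u. p * (\<phi>\<^sub>2 (?y u / ?x u) * ?x u ^ p) / right_deriv \<phi>\<^sub>1 1)) (at_right 0)"
    by (rule Lim_transform_eventually)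
  then show ?thesis by (simp add: I_def)
qed

end

section \<open>Normalization by the dimension and cancellation of the right derivative\<close>

theorem lemma4p4:
  fixes K L :: "(real ^ 'n) set" and \<phi>\<^sub>1 \<phi>\<^sub>2 :: "real \<Rightarrow> real" and i :: nat
  assumes "K \<in> convex_bodies" and "L \<in> convex_bodies"
    and "\<phi>\<^sub>1 \<in> orlicz_class" and "\<phi>\<^sub>2 \<in> orlicz_class"
    and "i < CARD('n)"
  shows "\<exists>D. ((\<lambda>\<epsilon>. (orlicz_width_integral i \<phi>\<^sub>1 \<phi>\<^sub>2 K \<epsilon> L - width_integral i K) / \<epsilon>) \<longlongrightarrow> D) (at_right 0) \<and>
    right_deriv \<phi>\<^sub>1 1 / (real CARD('n) - real i) * D =
      1 / real CARD('n) *
        (LINT u|sphere_measure. \<phi>\<^sub>2 (half_width L u / half_width K u) * half_width K u ^ (CARD('n) - i))"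
proof -
  interpret orlicz_pair \<phi>\<^sub>1 \<phi>\<^sub>2 using assms(3,4) by unfold_locales
  define p where "p = CARD('n) - i"
  define J where "J = (LINT u|sphere_measure. \<phi>\<^sub>2 (half_width L u / half_width K u) * half_width K u ^ p)"
  have p: "real CARD('n) - real i = real p" "p > 0"
    using assms(5) by (auto simp: p_def of_nat_diff)
  have r: "right_deriv \<phi>\<^sub>1 1 \<noteq> 0" using orlicz_right_deriv(2)[OF assms(3)] by simp
  \<comment> \<open>The witness \<open>D\<close> is the previous limit times \<open>1 / n\<close>,
    with n the dimension. Its factor \<open>p / right_deriv \<phi>\<^sub>1 1\<close> cancels against
    the prefactor of the claim, as \<open>p > 0\<close> and the right derivative is nonzero.\<close>
  have "((\<lambda>\<epsilon>. (orlicz_width_integral i \<phi>\<^sub>1 \<phi>\<^sub>2 K \<epsilon> L - width_integral i K) / \<epsilon>) \<longlongrightarrow>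
      1 / real CARD('n) * (p / right_deriv \<phi>\<^sub>1 1 * J)) (at_right 0)"
    using tendsto_mult_left[OF width_power_deriv[OF assms(1,2), of p], of "1 / real CARD('n)"]
    unfolding orlicz_width_integral_def width_integral_def width_integral_fun_def
      orlicz_half_width_eq_orlicz_root p_def[symmetric] J_def
    by (simp add: diff_divide_distrib right_diff_distrib)
  moreover have "right_deriv \<phi>\<^sub>1 1 / (real CARD('n) - real i) * (1 / real CARD('n) * (p / right_deriv \<phi>\<^sub>1 1 * J))
      = 1 / real CARD('n) * J"
    using p r by simp
  ultimately show ?thesis unfolding J_def p_def by blast
qed

end
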